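(* Let $(X_i)_{i<\omega}$ be an increasing sequence of countable sets, and for each $i<\omega$ let $<^i$ be a linear order on $X_i$ of order type $\omega$, such that $<^{i+1}|_{X_i}$ almost agrees with $<^i$ for all $i<\omega$. Then there are linear orders $\lessdot^i$ on $X_i$ of order type $\omega$ such that $\lessdot^0=<^0$, and for all $i<\omega$, $\lessdot^i$ almost agrees with $<^i$ and $\lessdot^{i+1}|_{X_i}=\lessdot^i$.
   Context: Two linear orders $<^1,<^2$ on a set $Z$ almost agree if there is a finite $Z_0\subseteq Z$ such that $<^1$ and $<^2$ coincide on $Z\setminus Z_0$. For $X\subseteq Y$ and an order $<$ on $Y$, $<|_X$ denotes its restriction to $X$. *)

theory Defs
  imports Main "HOL-Library.Countable_Set"
begin

text \<open>
  Linear orders are strict, following the notation \<open><\<close>. The library predicate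
  \<^const>\<open>strict_linear_order_on\<close> does not confine the relation to the carrier; the extra
  conjunct does, so that equality of relations is equality of orders.
\<close>

definition linear_order_of :: "'a set \<Rightarrow> 'a rel \<Rightarrow> bool" where
  "linear_order_of Z r \<longleftrightarrow> r \<subseteq> Z \<times> Z \<and> strict_linear_order_on Z r"

definition order_type_omega :: "'a set \<Rightarrow> 'a rel \<Rightarrow> bool" where
  "order_type_omega Z r \<longleftrightarrow>
     (\<exists>f :: nat \<Rightarrow> 'a. bij_betw f UNIV Z \<and> (\<forall>m n. (f m, f n) \<in> r \<longleftrightarrow> m < n))"

definition almost_agree :: "'a set \<Rightarrow> 'a rel \<Rightarrow> 'a rel \<Rightarrow> bool" where
  "almost_agree Z r s \<longleftrightarrow>
     (\<exists>Z\<^sub>0 \<subseteq> Z. finite Z\<^sub>0 \<and> Restr r (Z - Z\<^sub>0) = Restr s (Z - Z\<^sub>0))"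

end

theory Submission
  imports Defs
begin

text \<open>
  Extend one step at a time. If an order \<open>S\<close> on \<open>X\<close> agrees with an order \<open>R\<close> on \<open>Y \<supseteq> X\<close> outside
  a finite subset of \<open>X\<close>, enlarge that subset to a finite initial segment \<open>D\<close> of \<open>S\<close>. Putting \<open>D\<close>
  first, ordered by \<open>S\<close>, and then \<open>Y - D\<close>, ordered by \<open>R\<close>, gives an order on \<open>Y\<close> that extends \<open>S\<close>
  because \<open>D\<close> is an initial segment, and that differs from \<open>R\<close> only on pairs meeting the finite
  set \<open>D\<close>.
\<close>

lemma linear_order_of_iff:
  "linear_order_of Z r \<longleftrightarrow> r \<subseteq> Z \<times> Z \<and> trans r \<and> irrefl r \<and> total_on Z r"
  unfolding linear_order_of_def strict_linear_order_on_def by blast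

lemma linear_order_of_Restr:
  assumes "linear_order_of Z r" "W \<subseteq> Z"
  shows "linear_order_of W (Restr r W)"
  using assms unfolding linear_order_of_iff irrefl_def total_on_def
  by (simp add: trans_Restr) blast

lemma order_type_omega_if_rank:
  fixes rank :: "'a \<Rightarrow> nat"
  assumes infinite: "infinite Z" and inj: "inj_on rank Z"
    and rank_less_iff: "\<And>x y. x \<in> Z \<Longrightarrow> y \<in> Z \<Longrightarrow> rank x < rank y \<longleftrightarrow> (x, y) \<in> r"
  shows "order_type_omega Z r"
proof -
  let ?e = "enumerate (rank ` Z)"
  define f where "f = inv_into Z rank \<circ> ?e"
  have infinite_ranks: "infinite (rank ` Z)"
    using infinite inj by (simp add: finite_image_iff)
  have "bij_betw (inv_into Z rank) (rank ` Z) Z"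
    using inj by (intro bij_betw_inv_into inj_on_imp_bij_betw)
  with bij_enumerate[OF infinite_ranks] have "bij_betw f UNIV Z"
    unfolding f_def by (rule bij_betw_trans)
  moreover have "(f m, f n) \<in> r \<longleftrightarrow> m < n" for m n
  proof -
    have in_ranks: "?e k \<in> rank ` Z" for k
      by (rule enumerate_in_set[OF infinite_ranks])
    have f_in: "f k \<in> Z" and rank_f: "rank (f k) = ?e k" for k
      using inv_into_into[OF in_ranks] f_inv_into_f[OF in_ranks] by (simp_all add: f_def)
    have "(f m, f n) \<in> r \<longleftrightarrow> ?e m < ?e n"
      using rank_less_iff[OF f_in f_in] by (simp add: rank_f)
    also have "\<dots> \<longleftrightarrow> m < n"
      by (rule enumerate_mono_iff[OF infinite_ranks])
    finally show ?thesis .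
  qed
  ultimately show ?thesis
    unfolding order_type_omega_def by blast
qed

lemma card_predecessors_less_iff:
  assumes lin: "linear_order_of Z r" and finite: "\<And>y. y \<in> Z \<Longrightarrow> finite (r\<inverse> `` {y})"
    and "x \<in> Z" "y \<in> Z"
  shows "card (r\<inverse> `` {x}) < card (r\<inverse> `` {y}) \<longleftrightarrow> (x, y) \<in> r"
proof -
  have "trans r" "irrefl r" "total_on Z r"
    using lin by (simp_all add: linear_order_of_iff)
  have card_less: "card (r\<inverse> `` {u}) < card (r\<inverse> `` {v})" if "(u, v) \<in> r" "v \<in> Z" for u v
  proof (rule psubset_card_mono[OF finite[OF \<open>v \<in> Z\<close>]])
    show "r\<inverse> `` {u} \<subset> r\<inverse> `` {v}"
      using \<open>(u, v) \<in> r\<close> \<open>trans r\<close> \<open>irrefl r\<close> unfolding irrefl_def by (blast dest: transD)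
  qed
  show ?thesis
  proof
    assume "card (r\<inverse> `` {x}) < card (r\<inverse> `` {y})"
    then have "(y, x) \<notin> r" "x \<noteq> y"
      using card_less[of y x] \<open>x \<in> Z\<close> by auto
    then show "(x, y) \<in> r"
      using \<open>total_on Z r\<close> \<open>x \<in> Z\<close> \<open>y \<in> Z\<close> unfolding total_on_def by blast
  qed (use card_less \<open>y \<in> Z\<close> in blast)
qed

lemma order_type_omega_iff:
  assumes lin: "linear_order_of Z r"
  shows "order_type_omega Z r \<longleftrightarrow> infinite Z \<and> (\<forall>y\<in>Z. finite (r\<inverse> `` {y}))"
proof
  assume "order_type_omega Z r"
  then obtain f :: "nat \<Rightarrow> 'a"
    where bij: "bij_betw f UNIV Z" and less_iff: "\<And>m n. (f m, f n) \<in> r \<longleftrightarrow> m < n"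
    unfolding order_type_omega_def by blast
  have Z: "Z = range f"
    using bij by (simp add: bij_betw_def)
  have "finite (r\<inverse> `` {f n})" for n
  proof (rule finite_subset)
    show "r\<inverse> `` {f n} \<subseteq> f ` {..<n}"
      using lin less_iff unfolding linear_order_of_iff Z by blast
  qed simp
  moreover have "infinite Z"
    using bij bij_betw_finite by blast
  ultimately show "infinite Z \<and> (\<forall>y\<in>Z. finite (r\<inverse> `` {y}))"
    by (simp add: Z)
next
  assume "infinite Z \<and> (\<forall>y\<in>Z. finite (r\<inverse> `` {y}))"
  then have infinite: "infinite Z" and finite: "\<And>y. y \<in> Z \<Longrightarrow> finite (r\<inverse> `` {y})"
    by auto
  note less_iff = card_predecessors_less_iff[OF lin finite]
  have "inj_on (\<lambda>x. card (r\<inverse> `` {x})) Z"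
  proof (rule inj_onI)
    fix x y assume "x \<in> Z" "y \<in> Z" "card (r\<inverse> `` {x}) = card (r\<inverse> `` {y})"
    then have "(x, y) \<notin> r" "(y, x) \<notin> r"
      using less_iff by force+
    then show "x = y"
      using lin \<open>x \<in> Z\<close> \<open>y \<in> Z\<close> unfolding linear_order_of_iff total_on_def by blast
  qed
  with infinite show "order_type_omega Z r"
    by (rule order_type_omega_if_rank) (rule less_iff)
qed

lemma order_type_omega_Restr:
  assumes "linear_order_of Z r" "order_type_omega Z r" "W \<subseteq> Z" "infinite W"
  shows "order_type_omega W (Restr r W)"
proof -
  have "finite ((Restr r W)\<inverse> `` {y})" if "y \<in> W" for y
  proof (rule finite_subset)
    show "(Restr r W)\<inverse> `` {y} \<subseteq> r\<inverse> `` {y}"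
      by blast
    show "finite (r\<inverse> `` {y})"
      using assms that by (auto simp: order_type_omega_iff)
  qed
  with assms show ?thesis
    by (simp add: order_type_omega_iff linear_order_of_Restr)
qed

definition order_sum :: "'a set \<Rightarrow> 'a rel \<Rightarrow> 'a set \<Rightarrow> 'a rel \<Rightarrow> 'a rel" where
  "order_sum A r B s = r \<union> A \<times> B \<union> s"

lemma linear_order_of_order_sum:
  assumes "linear_order_of A r" "linear_order_of B s" "A \<inter> B = {}"
  shows "linear_order_of (A \<union> B) (order_sum A r B s)"
proof -
  have r: "r \<subseteq> A \<times> A" "trans r" "irrefl r" "total_on A r"
    and s: "s \<subseteq> B \<times> B" "trans s" "irrefl s" "total_on B s"
    using assms by (simp_all add: linear_order_of_iff)
  have "trans (order_sum A r B s)"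
    using r(1,2) s(1,2) \<open>A \<inter> B = {}\<close> unfolding order_sum_def
    by (intro transI) (blast dest: transD)
  moreover have "irrefl (order_sum A r B s)"
    using r(3) s(3) \<open>A \<inter> B = {}\<close> unfolding order_sum_def irrefl_def by blast
  moreover have "total_on (A \<union> B) (order_sum A r B s)"
    using r(4) s(4) unfolding order_sum_def total_on_def by blast
  ultimately show ?thesis
    using r(1) s(1) unfolding linear_order_of_iff order_sum_def by blast
qed

lemma order_type_omega_order_sum:
  assumes r: "linear_order_of A r" and s: "linear_order_of B s" and disjoint: "A \<inter> B = {}"
    and "finite A" and omega: "order_type_omega B s"
  shows "order_type_omega (A \<union> B) (order_sum A r B s)"
proof -
  have "infinite B" and finite_s: "\<And>y. y \<in> B \<Longrightarrow> finite (s\<inverse> `` {y})"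
    using omega by (simp_all add: order_type_omega_iff[OF s])
  have "finite ((order_sum A r B s)\<inverse> `` {y})" if "y \<in> A \<union> B" for y
  proof (rule finite_subset)
    show "(order_sum A r B s)\<inverse> `` {y} \<subseteq> A \<union> s\<inverse> `` {y}"
      using r unfolding order_sum_def linear_order_of_iff by blast
    have "s\<inverse> `` {y} = {}" if "y \<notin> B"
      using s that unfolding linear_order_of_iff by blast
    with finite_s have "finite (s\<inverse> `` {y})"
      by (cases "y \<in> B") simp_all
    with \<open>finite A\<close> show "finite (A \<union> s\<inverse> `` {y})"
      by simp
  qed
  with \<open>infinite B\<close> show ?thesis
    by (simp add: order_type_omega_iff linear_order_of_order_sum[OF r s disjoint])
qed

lemma order_sum_initial_segment:
  assumes "linear_order_of Z r" "D \<subseteq> Z" "r\<inverse> `` D \<subseteq> D"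
  shows "order_sum D (Restr r D) (Z - D) (Restr r (Z - D)) = r"
proof -
  have "D \<times> (Z - D) \<subseteq> r"
  proof clarify
    fix x y assume "x \<in> D" "y \<in> Z" "y \<notin> D"
    then have "(y, x) \<notin> r" "x \<noteq> y"
      using assms(3) by auto
    with assms(1,2) \<open>x \<in> D\<close> \<open>y \<in> Z\<close> show "(x, y) \<in> r"
      unfolding linear_order_of_iff total_on_def by blast
  qed
  moreover have "r \<subseteq> Z \<times> Z"
    using assms(1) by (simp add: linear_order_of_iff)
  ultimately show ?thesis
    using assms(3) unfolding order_sum_def by blast
qed

lemma Restr_order_sum_extension:
  assumes "X \<subseteq> Y" "linear_order_of X S" "D \<subseteq> X" "S\<inverse> `` D \<subseteq> D"
    and agree_off_D: "Restr R (X - D) = Restr S (X - D)"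
  shows "Restr (order_sum D (Restr S D) (Y - D) (Restr R (Y - D))) X = S"
proof -
  have "Restr (order_sum D (Restr S D) (Y - D) (Restr R (Y - D))) X =
      order_sum D (Restr S D) (X - D) (Restr R (X - D))"
    using \<open>X \<subseteq> Y\<close> \<open>D \<subseteq> X\<close> unfolding order_sum_def by blast
  also note agree_off_D
  also have "order_sum D (Restr S D) (X - D) (Restr S (X - D)) = S"
    using assms(2-4) by (rule order_sum_initial_segment)
  finally show ?thesis .
qed

lemma almost_agree_refl: "almost_agree Z r r"
  unfolding almost_agree_def by blast

lemma almost_agree_sym: "almost_agree Z r s \<Longrightarrow> almost_agree Z s r"
  unfolding almost_agree_def by metis

lemma almost_agree_trans:
  assumes "almost_agree Z r s" "almost_agree Z s t"
  shows "almost_agree Z r t"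
proof -
  obtain A B where A: "A \<subseteq> Z" "finite A" "Restr r (Z - A) = Restr s (Z - A)"
    and B: "B \<subseteq> Z" "finite B" "Restr s (Z - B) = Restr t (Z - B)"
    using assms unfolding almost_agree_def by blast
  have "Restr r (Z - (A \<union> B)) = Restr t (Z - (A \<union> B))"
    using A(3) B(3) by blast
  with A B show ?thesis
    unfolding almost_agree_def by (intro exI[of _ "A \<union> B"]) simp
qed

lemma almost_agree_Restr_iff: "almost_agree Z (Restr r Z) s \<longleftrightarrow> almost_agree Z r s"
proof -
  have "Restr (Restr r Z) (Z - W) = Restr r (Z - W)" for W
    by blast
  then show ?thesis
    unfolding almost_agree_def by simp
qed

lemma almost_agree_order_sum:
  assumes "finite A" "A \<inter> B = {}" "r \<subseteq> A \<times> A"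
  shows "almost_agree (A \<union> B) (order_sum A r B (Restr s B)) s"
proof -
  have "Restr (order_sum A r B (Restr s B)) (A \<union> B - A) = Restr s (A \<union> B - A)"
    using assms(2,3) unfolding order_sum_def by blast
  with \<open>finite A\<close> show ?thesis
    unfolding almost_agree_def by blast
qed

lemma almost_agree_off_initial_segment:
  assumes lin: "linear_order_of Z r" and omega: "order_type_omega Z r"
    and agree: "almost_agree Z s r"
  obtains D where "D \<subseteq> Z" "finite D" "r\<inverse> `` D \<subseteq> D" "Restr s (Z - D) = Restr r (Z - D)"
proof -
  obtain A where A: "A \<subseteq> Z" "finite A" "Restr s (Z - A) = Restr r (Z - A)"
    using agree unfolding almost_agree_def by blast
  define D where "D = A \<union> r\<inverse> `` A"
  show ?thesis
  proof
    show "D \<subseteq> Z"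
      using A(1) lin unfolding D_def linear_order_of_iff by blast
    have "r\<inverse> `` A = (\<Union>a\<in>A. r\<inverse> `` {a})"
      by blast
    with A(1,2) omega show "finite D"
      unfolding D_def by (auto simp: order_type_omega_iff[OF lin])
    have "trans r"
      using lin by (simp add: linear_order_of_iff)
    then show "r\<inverse> `` D \<subseteq> D"
      unfolding D_def by (blast dest: transD)
    show "Restr s (Z - D) = Restr r (Z - D)"
      using A(3) unfolding D_def by blast
  qed
qed

lemma extend_order_type_omega:
  assumes "X \<subseteq> Y"
    and S: "linear_order_of X S" "order_type_omega X S"
    and R: "linear_order_of Y R" "order_type_omega Y R"
    and agree: "almost_agree X R S"
  obtains T where "linear_order_of Y T" "order_type_omega Y T" "almost_agree Y T R" "Restr T X = S"
proof -
  obtain D where D: "D \<subseteq> X" "finite D" "S\<inverse> `` D \<subseteq> D"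
    and agree_off_D: "Restr R (X - D) = Restr S (X - D)"
    using almost_agree_off_initial_segment[OF S agree] by blast
  define T where "T = order_sum D (Restr S D) (Y - D) (Restr R (Y - D))"
  have Y: "D \<union> (Y - D) = Y" and disjoint: "D \<inter> (Y - D) = {}"
    using D(1) \<open>X \<subseteq> Y\<close> by auto
  have "infinite (Y - D)"
    using R D(2) by (simp add: order_type_omega_iff)
  then have omega_tail: "order_type_omega (Y - D) (Restr R (Y - D))"
    by (intro order_type_omega_Restr[OF R]) auto
  have lin_D: "linear_order_of D (Restr S D)"
    and lin_tail: "linear_order_of (Y - D) (Restr R (Y - D))"
    using S(1) R(1) D(1) by (auto intro: linear_order_of_Restr)
  show ?thesis
  proof
    show "linear_order_of Y T"
      using linear_order_of_order_sum[OF lin_D lin_tail disjoint] by (simp only: T_def Y)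
    show "order_type_omega Y T"
      using order_type_omega_order_sum[OF lin_D lin_tail disjoint D(2) omega_tail]
      by (simp only: T_def Y)
    show "almost_agree Y T R"
      using almost_agree_order_sum[OF D(2) disjoint Int_lower2, of S R] by (simp only: T_def Y)
    show "Restr T X = S"
      unfolding T_def using \<open>X \<subseteq> Y\<close> S(1) D(1,3) agree_off_D by (rule Restr_order_sum_extension)
  qed
qed

theorem lemmaA4:
  fixes X :: "nat \<Rightarrow> 'a set" and R :: "nat \<Rightarrow> 'a rel"
  assumes "\<And>i. X i \<subseteq> X (Suc i)"
    and "\<And>i. countable (X i)"
    and "\<And>i. linear_order_of (X i) (R i)"
    and "\<And>i. order_type_omega (X i) (R i)"
    and "\<And>i. almost_agree (X i) (Restr (R (Suc i)) (X i)) (R i)"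
  shows "\<exists>S :: nat \<Rightarrow> 'a rel.
           (\<forall>i. linear_order_of (X i) (S i) \<and> order_type_omega (X i) (S i)) \<and>
           S 0 = R 0 \<and>
           (\<forall>i. almost_agree (X i) (S i) (R i) \<and> Restr (S (Suc i)) (X i) = S i)"
proof -
  define admissible where "admissible i s \<longleftrightarrow> linear_order_of (X i) s \<and> order_type_omega (X i) s \<and>
    almost_agree (X i) s (R i) \<and> (i = 0 \<longrightarrow> s = R 0)" for i s
  have "\<exists>S. \<forall>i. admissible i (S i) \<and> Restr (S (Suc i)) (X i) = S i"
  proof (rule dependent_nat_choice)
    show "\<exists>s. admissible 0 s"
      using assms(3,4) almost_agree_refl unfolding admissible_def by blast
  next
    fix s i assume "admissible i s"
    then have s: "linear_order_of (X i) s" "order_type_omega (X i) s" "almost_agree (X i) s (R i)"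
      by (simp_all add: admissible_def)
    have "almost_agree (X i) (R (Suc i)) s"
      using assms(5)[of i] almost_agree_sym[OF s(3)] unfolding almost_agree_Restr_iff
      by (rule almost_agree_trans)
    then show "\<exists>t. admissible (Suc i) t \<and> Restr t (X i) = s"
      using extend_order_type_omega[OF assms(1) s(1,2) assms(3,4)]
      unfolding admissible_def by blast
  qed
  then show ?thesis
    unfolding admissible_def by blast
qed

end
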